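(* For $n\in\mathbb N$, $i=1,2$ let $(\Omega^i,\mathfrak F^i,\mathbb P_n^i)$ be standard probability spaces, and let $(\Omega,\mathfrak F,\mathbb P_n)$ be their product space. Let $(a_n)$ be a sequence of strictly positive reals with $\lim_na_n=+\infty$. Let $X,Y$ be Polish spaces with compatible distances $d_X$ and $d_Y$. Assume that for each $n$ there are measurable maps $F_n\colon Y\times\Omega^1\to X$, $G_n\colon X\times\Omega^2\to Y$, $\xi_n\colon\Omega\to X$ and $\eta_n\colon\Omega\to Y$ such that $\mathbb P_n$-a.s. $$\xi_n(\omega^1,\omega^2)=F_n(\eta_n(\omega^1,\omega^2),\omega^1),\qquad \eta_n(\omega^1,\omega^2)=G_n(\xi_n(\omega^1,\omega^2),\omega^2).$$ For fixed $x\in X$, $y\in Y$ define $f_n^y(\omega^1)=F_n(y,\omega^1)$, $g_n^x(\omega^2)=G_n(x,\omega^2)$, and let $\mu_n^y:=\mathbb P_n^1\circ(f_n^y)^{-1}\in\mathcal P(X)$ and $\nu_n^x:=\mathbb P_n^2\circ(g_n^x)^{-1}\in\mathcal P(Y)$ be the laws of $f_n^y$ and $g_n^x$ respectively. Assume that for fixed $x\in X$, $y\in Y$ there exists a positive function $q\equiv q^{x,y}\in C_{\mathrm b}(\mathbb R^+;\mathbb R^+)$ with $q(0)=0$ such that (i) $(\mu_n^y)$ satisfies a weak large deviations principle with speed $(a_n)$ and lower semicontinuous rate $x\mapsto K^y(x)$. (ii) $(\nu_n^x)$ satisfies a weak large deviations principle with speed $(a_n)$ and lower semicontinuous rate $y\mapsto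 J^x(y)$. (iii) For each $\varepsilon>0$ $$\varlimsup_n\tfrac1{a_n}\log\mathbb P_n\Big(d_X(\xi_n,x)+d_Y(\eta_n,y)\ge q\big(d_X(f_n^y,x)+d_Y(g_n^x,y)\big)+\varepsilon\Big)=-\infty.$$ (iv) For each $\varepsilon>0$ $$\varlimsup_n\tfrac1{a_n}\log\mathbb P_n\Big(d_X(f_n^y,x)+d_Y(g_n^x,y)\ge q\big(d_X(\xi_n,x)+d_Y(\eta_n,y)\big)+\varepsilon\Big)=-\infty.$$ Define $I\colon X\times Y\to[0,+\infty]$ as the lower semicontinuous envelope of the map $(x,y)\mapsto K^y(x)+J^x(y)$ and let $\gamma_n:=\mathbb P_n\circ(\xi_n,\eta_n)^{-1}$ be the law of $(\xi_n,\eta_n)$. Then $(\gamma_n)$ satisfies a weak large deviations principle with speed $(a_n)$ and rate $I$.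
   Context: $\mathcal P(X)$ denotes the Borel probability measures on $X$. $\mathbb R^+=[0,+\infty[$, and $C_{\mathrm b}(\mathbb R^+;\mathbb R^+)$ denotes the bounded continuous functions from $\mathbb R^+$ to $\mathbb R^+$. On the product space, $f_n^y$ and $g_n^x$ are regarded as functions of $(\omega^1,\omega^2)$ depending only on $\omega^1$ and $\omega^2$ respectively. Convention: $\log0=-\infty$. A sequence $(\mu_n)$ of Borel probability measures on a Polish space $Z$ satisfies a weak large deviations principle with speed $(a_n)$ and lower semicontinuous rate $I\colon Z\to[0,+\infty]$ iff $\varliminf_n\frac1{a_n}\log\mu_n(O)\ge-\inf_{z\in O}I(z)$ for each open $O\subset Z$ and $\varlimsup_n\frac1{a_n}\log\mu_n(K)\le-\inf_{z\in K}I(z)$ for each compact $K\subset Z$. The lower semicontinuous envelope of a function is the largest lower semicontinuous function bounded above by it. *)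

theory Defs
  imports "HOL-Probability.Probability"
begin

instance prod :: (polish_space, polish_space) polish_space ..

(* A standard Borel space carries the Borel sigma-algebra of some Polish topology. Completeness of
   the measure is not required. *)
definition standard_borel :: "'a measure \<Rightarrow> bool" where
  "standard_borel M \<longleftrightarrow>
     (\<exists>T. completely_metrizable_space T \<and> second_countable T \<and>
          topspace T = space M \<and> sets M = sigma_sets (space M) {U. openin T U})"

definition standard_prob_space :: "'a measure \<Rightarrow> bool" where
  "standard_prob_space P \<longleftrightarrow> prob_space P \<and> standard_borel P"

(* The metric need not be the one of the type class, and it need not be complete. *)
definition compatible_dist :: "('a::topological_space \<Rightarrow> 'a \<Rightarrow> real) \<Rightarrow> bool" where
  "compatible_dist d \<longleftrightarrow> Metric_space UNIV d \<and> Metric_space.mtopology UNIV d = euclidean"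

(* Only used on [0, 1]; the library's ln has ln 0 = 0. *)
definition elog :: "real \<Rightarrow> ereal" where
  "elog p = (if p = 0 then -\<infinity> else ereal (ln p))"

definition lsc :: "('z::topological_space \<Rightarrow> ennreal) \<Rightarrow> bool" where
  "lsc f \<longleftrightarrow> (\<forall>t. open {z. t < f z})"

definition lsc_envelope :: "('z::topological_space \<Rightarrow> ennreal) \<Rightarrow> 'z \<Rightarrow> ennreal" where
  "lsc_envelope f = (GREATEST g. lsc g \<and> g \<le> f)"

lemma lsc_SUP:
  assumes "\<And>g. g \<in> A \<Longrightarrow> lsc g"
  shows "lsc (\<lambda>z. SUP g\<in>A. g z)"
proof -
  have "open (\<Union>g\<in>A. {z. t < g z})" for t
    using assms by (auto simp: lsc_def)
  moreover have "{z. t < (SUP g\<in>A. g z)} = (\<Union>g\<in>A. {z. t < g z})" for t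
    by (auto simp: less_SUP_iff)
  ultimately show ?thesis by (simp add: lsc_def)
qed

lemma lsc_envelope_eq_SUP: "lsc_envelope f = (\<lambda>z. SUP g\<in>{g. lsc g \<and> g \<le> f}. g z)"
  unfolding lsc_envelope_def
  by (rule Greatest_equality) (auto simp: le_fun_def intro!: lsc_SUP SUP_least intro: SUP_upper)

lemma lsc_lsc_envelope: "lsc (lsc_envelope f)"
  unfolding lsc_envelope_eq_SUP by (rule lsc_SUP) simp

lemma lsc_envelope_le: "lsc_envelope f \<le> f"
  unfolding lsc_envelope_eq_SUP by (auto simp: le_fun_def intro!: SUP_least)

lemma lsc_envelope_greatest: "lsc g \<Longrightarrow> g \<le> f \<Longrightarrow> g \<le> lsc_envelope f"
  unfolding lsc_envelope_eq_SUP by (auto simp: le_fun_def intro: SUP_upper)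

(* The infimum over the empty set is infinity, hence the lower bound for O = {} is trivial. *)
definition weak_LDP ::
    "(nat \<Rightarrow> 'z::polish_space measure) \<Rightarrow> (nat \<Rightarrow> real) \<Rightarrow> ('z \<Rightarrow> ennreal) \<Rightarrow> bool" where
  "weak_LDP \<mu> a I \<longleftrightarrow>
     (\<forall>n. prob_space (\<mu> n) \<and> sets (\<mu> n) = sets borel) \<and>
     lsc I \<and>
     (\<forall>U. open U \<longrightarrow>
        liminf (\<lambda>n. ereal (1 / a n) * elog (measure (\<mu> n) U)) \<ge> - enn2ereal (INF z\<in>U. I z)) \<and>
     (\<forall>C. compact C \<longrightarrow>
        limsup (\<lambda>n. ereal (1 / a n) * elog (measure (\<mu> n) C)) \<le> - enn2ereal (INF z\<in>C. I z))"

end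

theory Submission
  imports Defs
begin

text \<open>
  Near a fixed point \<open>(x, y)\<close>, the pair \<open>(\<xi>\<^sub>n, \<eta>\<^sub>n)\<close> can be exchanged with the pair \<open>(f\<^sub>n\<^sup>y, g\<^sub>n\<^sup>x)\<close>: by the two
  comparison hypotheses, closeness of one pair to \<open>(x, y)\<close> forces closeness of the other, outside an
  event of superexponentially small probability (\<open>exponential_equivalence_transfer\<close>). The two
  components of the second pair live on different factors of the product space, so they are
  independent: the probability that they lie in \<open>U \<times> V\<close> is the product of the two laws
  (\<open>measure_pair_rectangle\<close>), and the logarithmic rates add up. Thus \<open>\<gamma>\<^sub>n\<close> has, on
  small neighbourhoods of \<open>(x, y)\<close>, the rate \<open>\<phi>(x, y) = K\<^sup>y(x) + J\<^sup>x(y)\<close>, both from above and from below.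
  The comparison depends on \<open>(x, y)\<close>, which does no harm since a weak large deviations principle
  can be read off from such local bounds (\<open>weak_LDP_of_local_bounds\<close>): upper bounds on compact sets
  come from finite covers, and on open sets \<open>\<phi>\<close> and its lower semicontinuous envelope have the same
  infimum.

  The delicate step is the local upper bound for the laws of \<open>f\<^sub>n\<^sup>y\<close> and \<open>g\<^sub>n\<^sup>x\<close>. Their weak principles bound the
  measures of compact sets, whereas neighbourhoods in a Polish space need not be relatively compact,
  so mass might hide in small balls without charging any compact set at the rate in question. It
  cannot (\<open>weak_LDP_local_upper_bound\<close>): inner regularity places the mass found at time \<open>n\<^sub>k\<close> in the
  \<open>k\<close>-th of a sequence of shrinking balls on a compact subset, and these subsets shrink to the point, so their union
  with it is one compact set that carries the mass at infinitely many times.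
\<close>

section \<open>Logarithmic rates\<close>

text \<open>
  The quantity whose limits a large deviations principle controls: \<open>r\<close> is the value of the speed and
  \<open>p\<close> a probability.
\<close>

abbreviation (input) log_rate :: "real \<Rightarrow> real \<Rightarrow> ereal" where
  "log_rate r p \<equiv> ereal (1 / r) * elog p"

text \<open>
  Comparing a logarithmic rate with a real number is comparing \<open>p\<close> with an exponential. Through this
  and its mirror image, the limit arguments below become inequalities between real numbers, and the
  value \<open>-\<infinity>\<close> needs no case of its own.
\<close>

lemma log_rate_less_iff:
  assumes "r > 0" "p \<ge> 0"
  shows "log_rate r p < ereal z \<longleftrightarrow> p < exp (r * z)"
proof (cases "p = 0")
  case False
  with assms have "log_rate r p < ereal z \<longleftrightarrow> ln p < r * z"
    by (simp add: elog_def field_simps)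
  also have "\<dots> \<longleftrightarrow> p < exp (r * z)"
    using assms False by (metis exp_less_cancel_iff exp_ln order_le_less)
  finally show ?thesis .
qed (use assms in \<open>simp add: elog_def\<close>)

lemma less_log_rate_iff:
  assumes "r > 0" "p \<ge> 0"
  shows "ereal z < log_rate r p \<longleftrightarrow> exp (r * z) < p"
proof (cases "p = 0")
  case False
  with assms have "ereal z < log_rate r p \<longleftrightarrow> r * z < ln p"
    by (simp add: elog_def field_simps)
  also have "\<dots> \<longleftrightarrow> exp (r * z) < p"
    using assms False by (metis exp_less_cancel_iff exp_ln order_le_less)
  finally show ?thesis .
qed (use assms in \<open>simp add: elog_def\<close>)

lemma log_rate_mono:
  assumes "r > 0" "0 \<le> p" "p \<le> q"
  shows "log_rate r p \<le> log_rate r q"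
  using assms by (auto simp: elog_def divide_right_mono)

lemma log_rate_nonpos:
  assumes "r > 0" "0 \<le> p" "p \<le> 1"
  shows "log_rate r p \<le> 0"
  using log_rate_mono[OF assms] by (simp add: elog_def zero_ereal_def)

lemma log_rate_mult:
  assumes "r > 0" "0 \<le> p" "0 \<le> q"
  shows "log_rate r (p * q) = log_rate r p + log_rate r q"
  using assms by (auto simp: elog_def ln_mult add_divide_distrib)

lemma limsup_log_rate_nonpos:
  assumes "\<And>n. a n > 0" "\<And>n. prob_space (M n)"
  shows "limsup (\<lambda>n. log_rate (a n) (measure (M n) A)) \<le> 0"
proof (intro Limsup_bounded always_eventually allI)
  fix n
  interpret prob_space "M n" by fact
  show "log_rate (a n) (measure (M n) A) \<le> 0" using assms(1) by (intro log_rate_nonpos) auto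
qed

text \<open>
  Constant factors are invisible on the exponential scale.
\<close>

lemma eventually_two_exp_le:
  fixes a :: "nat \<Rightarrow> real"
  assumes "filterlim a at_top sequentially" "z < z'"
  shows "\<forall>\<^sub>F n in sequentially. 2 * exp (a n * z) \<le> exp (a n * z')"
proof -
  have "\<forall>\<^sub>F n in sequentially. ln 2 / (z' - z) \<le> a n"
    using assms(1) by (simp add: filterlim_at_top)
  then show ?thesis
  proof eventually_elim
    case (elim n)
    then have "ln 2 \<le> a n * z' - a n * z"
      using assms(2) by (simp add: field_simps)
    then have "exp (ln 2) \<le> exp (a n * z' - a n * z)" by (simp only: exp_le_cancel_iff)
    then show ?case by (simp add: exp_diff field_simps)
  qed
qed

text \<open>
  On the exponential scale a sum behaves like a maximum, as its value is at most twice the larger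
  term.
\<close>

lemma limsup_log_rate_add_le:
  assumes a: "\<And>n. a n > 0" "filterlim a at_top sequentially"
    and nonneg: "\<And>n. 0 \<le> p n" "\<And>n. 0 \<le> e n" "\<And>n. 0 \<le> b n"
    and le: "\<And>n. p n \<le> e n + b n"
    and e: "limsup (\<lambda>n. log_rate (a n) (e n)) \<le> c"
    and b: "limsup (\<lambda>n. log_rate (a n) (b n)) \<le> c"
  shows "limsup (\<lambda>n. log_rate (a n) (p n)) \<le> c"
  unfolding Limsup_le_iff
proof (intro allI impI)
  fix y assume "c < y"
  then obtain z' where z': "c < ereal z'" "ereal z' < y" using ereal_dense2 by blast
  then obtain z where z: "c < ereal z" "ereal z < ereal z'" using ereal_dense2 by blast
  \<comment> \<open>The gap between \<open>z\<close> and \<open>z'\<close> absorbs the factor two of \<open>e n + b n \<le> 2 * max (e n) (b n)\<close>.\<close>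
  have "\<forall>\<^sub>F n in sequentially. log_rate (a n) (e n) < ereal z"
    "\<forall>\<^sub>F n in sequentially. log_rate (a n) (b n) < ereal z"
    using e b z(1) by (auto simp: Limsup_le_iff)
  moreover have "\<forall>\<^sub>F n in sequentially. 2 * exp (a n * z) \<le> exp (a n * z')"
    using z(2) by (intro eventually_two_exp_le a) simp
  ultimately show "\<forall>\<^sub>F n in sequentially. log_rate (a n) (p n) < y"
  proof eventually_elim
    case (elim n)
    then have "e n < exp (a n * z)" "b n < exp (a n * z)"
      by (simp_all only: log_rate_less_iff a(1) nonneg)
    then have "p n < exp (a n * z')" using le[of n] elim by linarith
    then have "log_rate (a n) (p n) < ereal z'" by (simp only: log_rate_less_iff a(1) nonneg)
    then show ?case using z'(2) by (rule order.strict_trans)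
  qed
qed

text \<open>
  A superexponentially small term \<open>b n\<close> cannot account for a lower bound at a finite rate, so the bound
  passes to the other summand.
\<close>

lemma le_liminf_log_rate_of_negligible:
  assumes a: "\<And>n. a n > 0" "filterlim a at_top sequentially"
    and nonneg: "\<And>n. 0 \<le> p n" "\<And>n. 0 \<le> e n" "\<And>n. 0 \<le> b n"
    and le: "\<And>n. p n \<le> e n + b n"
    and p: "c \<le> liminf (\<lambda>n. log_rate (a n) (p n))"
    and b: "limsup (\<lambda>n. log_rate (a n) (b n)) = -\<infinity>"
  shows "c \<le> liminf (\<lambda>n. log_rate (a n) (e n))"
  unfolding le_Liminf_iff
proof (intro allI impI)
  fix y assume "y < c"
  then obtain z where z: "y < ereal z" "ereal z < c" using ereal_dense2 by blast
  then obtain z' where z': "ereal z < ereal z'" "ereal z' < c" using ereal_dense2 by blast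
  have "\<forall>\<^sub>F n in sequentially. ereal z' < log_rate (a n) (p n)"
    using p z'(2) by (auto simp: le_Liminf_iff)
  moreover have "\<forall>\<^sub>F n in sequentially. log_rate (a n) (b n) < ereal z"
    by (rule Limsup_lessD) (simp add: b)
  moreover have "\<forall>\<^sub>F n in sequentially. 2 * exp (a n * z) \<le> exp (a n * z')"
    using z'(1) by (intro eventually_two_exp_le a) simp
  ultimately show "\<forall>\<^sub>F n in sequentially. y < log_rate (a n) (e n)"
  proof eventually_elim
    case (elim n)
    then have "exp (a n * z') < p n" "b n < exp (a n * z)"
      by (simp_all only: log_rate_less_iff less_log_rate_iff a(1) nonneg)
    then have "exp (a n * z) < e n" using le[of n] elim by linarith
    then have "ereal z < log_rate (a n) (e n)" by (simp only: less_log_rate_iff a(1) nonneg)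
    then show ?case using z(1) by (rule order.strict_trans[rotated])
  qed
qed

section \<open>Local bounds implied by a weak large deviations principle\<close>

text \<open>
  An open set of a cover that contains \<open>x\<close> absorbs all but finitely many of the sets \<open>C k\<close>.
\<close>

lemma compact_insert_Union_shrinking:
  fixes x :: "'a::metric_space"
  assumes C: "\<And>k. compact (C k)" "\<And>k. C k \<subseteq> ball x (1 / real (Suc k))"
  shows "compact (insert x (\<Union>k. C k))"
proof (rule Topological_Spaces.compactI)
  fix \<C> assume op: "\<forall>t\<in>\<C>. open t" and cov: "insert x (\<Union>k. C k) \<subseteq> \<Union>\<C>"
  then obtain U where U: "U \<in> \<C>" "x \<in> U" by auto
  then obtain e where e: "e > 0" "ball x e \<subseteq> U" using op open_contains_ball by metis
  obtain N where N: "1 / real (Suc N) < e" using nat_approx_posE[OF e(1)] by blast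
  have tail: "C k \<subseteq> U" if "k \<ge> N" for k
  proof -
    have "1 / real (Suc k) \<le> 1 / real (Suc N)" using that by (intro divide_left_mono) auto
    then have "ball x (1 / real (Suc k)) \<subseteq> ball x e" using N by (intro subset_ball) linarith
    then show ?thesis using C(2) e(2) by blast
  qed
  have "compact (\<Union>k<N. C k)" using C(1) by (intro compact_UN) auto
  moreover have "(\<Union>k<N. C k) \<subseteq> \<Union>\<C>" using cov by blast
  ultimately obtain \<D> where D: "\<D> \<subseteq> \<C>" "finite \<D>" "(\<Union>k<N. C k) \<subseteq> \<Union>\<D>"
    using compactE[of "\<Union>k<N. C k" \<C>] op by metis
  show "\<exists>\<C>'\<subseteq>\<C>. finite \<C>' \<and> insert x (\<Union>k. C k) \<subseteq> \<Union>\<C>'"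
  proof (intro exI[of _ "insert U \<D>"] conjI)
    have "C k \<subseteq> \<Union>(insert U \<D>)" for k
      using D(3) tail by (cases "k < N") (auto simp: not_less)
    then show "insert x (\<Union>k. C k) \<subseteq> \<Union>(insert U \<D>)" using U by blast
  qed (use U D in auto)
qed

text \<open>
  Inner regularity of finite Borel measures on Polish spaces.
\<close>

lemma exists_compact_subset_measure_gt:
  fixes M :: "'z::polish_space measure"
  assumes "prob_space M" "sets M = sets borel" "B \<in> sets borel" "0 \<le> s" "s < measure M B"
  obtains C where "compact C" "C \<subseteq> B" "s < measure M C"
proof -
  interpret prob_space M by fact
  have "ennreal s < emeasure M B"
    using assms by (simp add: emeasure_eq_measure ennreal_less_iff)
  also have "\<dots> = (SUP K \<in> {K. K \<subseteq> B \<and> compact K}. emeasure M K)"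
    using assms by (intro inner_regular) auto
  finally show ?thesis
    using that assms(4) by (auto simp: less_SUP_iff emeasure_eq_measure ennreal_less_iff)
qed

text \<open>
  The point where a weak principle, whose upper bound concerns compact sets only, is shown to control
  small neighbourhoods, although these need not be relatively compact. Choose \<open>t'\<close> strictly between
  \<open>t\<close> and \<open>I x\<close>, and let \<open>B k\<close> be the part of the ball of radius \<open>1 / (k + 1)\<close> where \<open>I\<close> exceeds \<open>t'\<close>, an
  open set by lower semicontinuity. If no neighbourhood of \<open>x\<close> had asymptotic rate \<open>-t\<close> or less, there
  would be arbitrarily large times \<open>n k\<close> at which \<open>B k\<close> has rate above \<open>-t\<close>, and by inner regularity so
  would a compact subset \<open>C k\<close> of it. The sets \<open>C k\<close> and the point \<open>x\<close> form one compact set on which \<open>I\<close>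
  exceeds \<open>t'\<close>, and its rates violate the upper bound for compact sets.
\<close>

lemma weak_LDP_local_upper_bound:
  assumes a: "\<And>n. a n > 0"
    and LDP: "weak_LDP \<mu> a I" and t: "t < I x"
  obtains U where "open U" "x \<in> U"
    "limsup (\<lambda>n. log_rate (a n) (measure (\<mu> n) U)) \<le> - enn2ereal t"
proof (rule ccontr)
  assume "\<not> thesis"
  with that have neg: "- enn2ereal t < limsup (\<lambda>n. log_rate (a n) (measure (\<mu> n) U))"
    if "open U" "x \<in> U" for U
    using \<open>open U\<close> \<open>x \<in> U\<close> by force
  have prob: "prob_space (\<mu> n)" and sets: "sets (\<mu> n) = sets borel" for n
    using LDP by (auto simp: weak_LDP_def)
  obtain t' where t': "t < t'" "t' < I x" using t dense by blast
  from t'(1) obtain s where s: "t = ennreal s" "s \<ge> 0" by (cases t) auto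
  define B where "B k = ball x (1 / real (Suc k)) \<inter> {z. t' < I z}" for k
  have B: "open (B k)" "x \<in> B k" for k
    using LDP t'(2) by (auto simp: B_def weak_LDP_def lsc_def)
  \<comment> \<open>Requiring \<open>n \<ge> k\<close> makes the exceptional times unbounded.\<close>
  have "\<exists>n\<ge>k. ereal (- s) < log_rate (a n) (measure (\<mu> n) (B k))" for k
  proof (rule ccontr)
    assume "\<not> ?thesis"
    then have "limsup (\<lambda>n. log_rate (a n) (measure (\<mu> n) (B k))) \<le> ereal (- s)"
      by (intro Limsup_bounded) (auto simp: eventually_sequentially not_less)
    with neg[OF B] show False using s by (simp add: enn2ereal_ennreal order.strict_iff_not)
  qed
  then obtain n where n: "n k \<ge> k" "ereal (- s) < log_rate (a (n k)) (measure (\<mu> (n k)) (B k))" for k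
    by metis
  have "\<exists>C. compact C \<and> C \<subseteq> B k \<and> exp (a (n k) * - s) < measure (\<mu> (n k)) C" for k
    by (rule exists_compact_subset_measure_gt[OF prob sets, of "B k" "exp (a (n k) * - s)" "n k"])
      (use n B a in \<open>auto simp: less_log_rate_iff\<close>)
  then obtain C where C: "compact (C k)" "C k \<subseteq> B k"
    "exp (a (n k) * - s) < measure (\<mu> (n k)) (C k)" for k
    by metis
  define D where "D = insert x (\<Union>k. C k)"
  have compact_D: "compact D"
    unfolding D_def using C(1,2) by (intro compact_insert_Union_shrinking) (auto simp: B_def)
  have "limsup (\<lambda>n. log_rate (a n) (measure (\<mu> n) D)) \<le> - enn2ereal (INF z\<in>D. I z)"
    using LDP compact_D by (simp add: weak_LDP_def)
  also have "t' \<le> (INF z\<in>D. I z)"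
    using t' C(2) by (intro INF_greatest) (force simp: D_def B_def)
  then have "- enn2ereal (INF z\<in>D. I z) \<le> - enn2ereal t'"
    by (simp add: less_eq_ennreal.rep_eq)
  also have "\<dots> < ereal (- s)"
    using t'(1) s
    by (metis enn2ereal_ennreal ereal_minus_less_minus less_ennreal.rep_eq uminus_ereal.simps(1))
  finally obtain N where N: "\<And>m. m \<ge> N \<Longrightarrow> log_rate (a m) (measure (\<mu> m) D) < ereal (- s)"
    using Limsup_lessD eventually_sequentially by force
  have "measure (\<mu> (n N)) (C N) \<le> measure (\<mu> (n N)) D"
  proof -
    interpret prob_space "\<mu> (n N)" by (rule prob)
    show ?thesis
      using compact_D sets by (intro finite_measure_mono) (auto simp: D_def compact_imp_closed)
  qed
  with C(3)[of N] N[OF n(1)] a[of "n N"] show False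
    by (simp add: log_rate_less_iff)
qed

text \<open>
  The level zero is admissible even where the rate vanishes, as logarithmic rates of probabilities are
  nonpositive. This case is needed when the rate of a sum is split between its summands.
\<close>

lemma weak_LDP_local_upper_bound_or_zero:
  assumes a: "\<And>n. a n > 0"
    and LDP: "weak_LDP \<mu> a I" and t: "t < I x \<or> t = 0"
  obtains U where "open U" "x \<in> U"
    "limsup (\<lambda>n. log_rate (a n) (measure (\<mu> n) U)) \<le> - enn2ereal t"
proof (cases "t < I x")
  case True
  then show ?thesis using weak_LDP_local_upper_bound[OF a LDP] that by blast
next
  case False
  then have "t = 0" using t by simp
  then show ?thesis
    using that[of UNIV] limsup_log_rate_nonpos[of a \<mu>, OF a] LDP
    by (simp add: weak_LDP_def zero_ennreal.rep_eq)
qed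

lemma weak_LDP_local_lower_bound:
  assumes "weak_LDP \<mu> a I" "open U" "x \<in> U"
  shows "- enn2ereal (I x) \<le> liminf (\<lambda>n. log_rate (a n) (measure (\<mu> n) U))"
proof -
  have "(INF z\<in>U. I z) \<le> I x" using assms(3) by (rule INF_lower)
  then have "- enn2ereal (I x) \<le> - enn2ereal (INF z\<in>U. I z)"
    by (simp add: less_eq_ennreal.rep_eq)
  also have "\<dots> \<le> liminf (\<lambda>n. log_rate (a n) (measure (\<mu> n) U))"
    using assms by (simp add: weak_LDP_def)
  finally show ?thesis .
qed

section \<open>A weak large deviations principle from local bounds\<close>

lemma limsup_log_rate_Union_le:
  assumes a: "\<And>n. a n > 0" "filterlim a at_top sequentially"
    and M: "\<And>n. prob_space (M n) \<and> sets (M n) = sets borel"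
    and "finite \<U>"
    and "\<And>U. U \<in> \<U> \<Longrightarrow> open U \<and> limsup (\<lambda>n. log_rate (a n) (measure (M n) U)) \<le> c"
  shows "limsup (\<lambda>n. log_rate (a n) (measure (M n) (\<Union>\<U>))) \<le> c"
  using assms(4,5)
proof (induction rule: finite_induct)
  case empty
  have "log_rate (a n) (measure (M n) (\<Union>{})) \<le> c" for n
    using a(1)[of n] by (simp add: elog_def)
  then show ?case by (intro Limsup_bounded always_eventually allI)
next
  case (insert U \<U>)
  show ?case
  proof (rule limsup_log_rate_add_le[OF a])
    fix n
    interpret prob_space "M n" using M by blast
    have "U \<in> sets (M n)" "\<Union>\<U> \<in> sets (M n)" using insert.prems M by (auto intro!: borel_open open_Union)
    then show "measure (M n) (\<Union>(insert U \<U>)) \<le> measure (M n) U + measure (M n) (\<Union>\<U>)"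
      using measure_Un_le[of U "M n" "\<Union>\<U>"] by simp
  qed (use insert in auto)
qed

text \<open>
  Lower bounds on open sets cannot tell a function from its lower semicontinuous envelope.
\<close>

lemma INF_lsc_envelope_open:
  assumes "open U"
  shows "(INF z\<in>U. lsc_envelope \<phi> z) = (INF z\<in>U. \<phi> z)"
proof (rule antisym)
  show "(INF z\<in>U. lsc_envelope \<phi> z) \<le> (INF z\<in>U. \<phi> z)"
    using lsc_envelope_le[of \<phi>] by (intro INF_mono) (auto simp: le_fun_def)
  \<comment> \<open>This minorant of \<open>\<phi>\<close> is lower semicontinuous because \<open>U\<close> is open.\<close>
  define h where "h z = (if z \<in> U then INF z\<in>U. \<phi> z else 0)" for z
  have "{z. t < h z} = (if t < (INF z\<in>U. \<phi> z) then U else {})" for t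
    by (auto simp: h_def)
  then have "lsc h" using assms by (simp add: lsc_def)
  moreover have "h \<le> \<phi>" by (auto simp: h_def le_fun_def intro: INF_lower)
  ultimately have "h \<le> lsc_envelope \<phi>" by (rule lsc_envelope_greatest)
  then show "(INF z\<in>U. \<phi> z) \<le> (INF z\<in>U. lsc_envelope \<phi> z)"
    by (intro INF_greatest) (metis h_def le_funD)
qed

lemma le_enn2ereal_e2ennreal: "x \<le> enn2ereal (e2ennreal x)"
  by (cases "0 \<le> x") (auto simp: enn2ereal_e2ennreal not_le intro: order.trans[OF less_imp_le])

text \<open>
  A weak principle is a local statement: the lower bound on an open set follows from the bounds at its
  points, and the upper bound on a compact set from a finite cover by the neighbourhoods given by
  \<open>upper\<close>.
\<close>

lemma weak_LDP_of_local_bounds: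
  fixes \<phi> :: "'z::polish_space \<Rightarrow> ennreal"
  assumes a: "\<And>n. a n > 0" "filterlim a at_top sequentially"
    and M: "\<And>n. prob_space (M n) \<and> sets (M n) = sets borel"
    and lower: "\<And>z U. open U \<Longrightarrow> z \<in> U \<Longrightarrow>
      - enn2ereal (\<phi> z) \<le> liminf (\<lambda>n. log_rate (a n) (measure (M n) U))"
    and upper: "\<And>z t. t < \<phi> z \<Longrightarrow> \<exists>U. open U \<and> z \<in> U \<and>
      limsup (\<lambda>n. log_rate (a n) (measure (M n) U)) \<le> - enn2ereal t"
  shows "weak_LDP M a (lsc_envelope \<phi>)"
  unfolding weak_LDP_def
proof (intro conjI allI impI lsc_lsc_envelope)
  fix U :: "'z set" assume U: "open U"
  let ?L = "liminf (\<lambda>n. log_rate (a n) (measure (M n) U))"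
  \<comment> \<open>The bound on each point is moved to \<^typ>\<open>ennreal\<close>, where the infimum over \<open>U\<close> is taken; \<^const>\<open>e2ennreal\<close>
    truncates negative values to zero, which can only increase \<open>- ?L\<close>.\<close>
  have "e2ennreal (- ?L) \<le> (INF z\<in>U. \<phi> z)"
  proof (rule INF_greatest)
    fix z assume "z \<in> U"
    then have "- ?L \<le> enn2ereal (\<phi> z)" using lower[OF U] by (simp add: ereal_uminus_le_reorder)
    then have "e2ennreal (- ?L) \<le> e2ennreal (enn2ereal (\<phi> z))" by (rule e2ennreal_mono)
    then show "e2ennreal (- ?L) \<le> \<phi> z" by simp
  qed
  then have "enn2ereal (e2ennreal (- ?L)) \<le> enn2ereal (INF z\<in>U. \<phi> z)"
    by (simp add: less_eq_ennreal.rep_eq)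
  then have "- ?L \<le> enn2ereal (INF z\<in>U. \<phi> z)"
    by (rule order_trans[OF le_enn2ereal_e2ennreal])
  then show "- enn2ereal (INF z\<in>U. lsc_envelope \<phi> z) \<le> ?L"
    unfolding INF_lsc_envelope_open[OF U] by (simp add: ereal_uminus_le_reorder)
next
  fix C :: "'z set" assume C: "compact C"
  let ?L = "limsup (\<lambda>n. log_rate (a n) (measure (M n) C))"
  have bound: "?L \<le> - enn2ereal t" if t: "t < (INF z\<in>C. lsc_envelope \<phi> z)" for t
  proof -
    have "t < \<phi> z" if "z \<in> C" for z
      using t INF_lower[OF that, of "lsc_envelope \<phi>"] lsc_envelope_le[of \<phi>]
      by (meson le_funD order_less_le_trans)
    then have "\<forall>z\<in>C. \<exists>U. open U \<and> z \<in> U \<and>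
        limsup (\<lambda>n. log_rate (a n) (measure (M n) U)) \<le> - enn2ereal t"
      using upper by blast
    then obtain U where U: "\<And>z. z \<in> C \<Longrightarrow> open (U z) \<and> z \<in> U z \<and>
        limsup (\<lambda>n. log_rate (a n) (measure (M n) (U z))) \<le> - enn2ereal t"
      by metis
    obtain D where D: "D \<subseteq> C" "finite D" "C \<subseteq> (\<Union>z\<in>D. U z)"
    proof (rule compactE_image[OF C])
      show "open (U z)" if "z \<in> C" for z using U[OF that] by blast
      show "C \<subseteq> (\<Union>z\<in>C. U z)" using U by blast
    qed
    have "measure (M n) C \<le> measure (M n) (\<Union>(U ` D))" for n
    proof -
      interpret prob_space "M n" using M by blast
      have "open (\<Union>(U ` D))" using D U by (intro open_UN) auto
      then show ?thesis using D(3) M by (intro finite_measure_mono) auto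
    qed
    then have "?L \<le> limsup (\<lambda>n. log_rate (a n) (measure (M n) (\<Union>(U ` D))))"
      by (intro Limsup_mono always_eventually allI log_rate_mono a) auto
    also have "\<dots> \<le> - enn2ereal t"
      using D U by (intro limsup_log_rate_Union_le a M) auto
    finally show ?thesis .
  qed
  show "?L \<le> - enn2ereal (INF z\<in>C. lsc_envelope \<phi> z)"
  proof (rule ccontr)
    assume "\<not> ?thesis"
    then have "- ?L < enn2ereal (INF z\<in>C. lsc_envelope \<phi> z)"
      by (simp add: ereal_uminus_less_reorder not_le)
    moreover have "0 \<le> - ?L"
      using limsup_log_rate_nonpos[of a M C, OF a(1)] M by simp
    ultimately have "e2ennreal (- ?L) < (INF z\<in>C. lsc_envelope \<phi> z)"
      by (simp add: less_ennreal.rep_eq enn2ereal_e2ennreal)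
    then obtain t where t: "e2ennreal (- ?L) < t" "t < (INF z\<in>C. lsc_envelope \<phi> z)"
      using dense by blast
    from t(1) have "- ?L < enn2ereal t"
      using \<open>0 \<le> - ?L\<close> by (simp add: less_ennreal.rep_eq enn2ereal_e2ennreal)
    moreover have "- (- enn2ereal t) \<le> - ?L"
      using bound[OF t(2)] by (simp only: ereal_minus_le_minus)
    ultimately show False by simp
  qed
qed (use M in auto)

section \<open>Closeness with respect to compatible distances\<close>

text \<open>
  A compatible metric may differ from the one of the type class, so its balls have to be related to the
  topology of the space by hand.
\<close>

lemma compatible_dist_properties:
  fixes d :: "'a::topological_space \<Rightarrow> 'a \<Rightarrow> real"
  assumes "compatible_dist d"
  shows compatible_dist_nonneg: "0 \<le> d z x"
    and compatible_dist_self: "d x x = 0"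
    and compatible_dist_continuous: "continuous_on UNIV (\<lambda>z. d z x)"
    and compatible_dist_nhd: "open U \<Longrightarrow> x \<in> U \<Longrightarrow> \<exists>r>0. \<forall>z. d z x < r \<longrightarrow> z \<in> U"
proof -
  interpret Metric_space UNIV d using assms by (simp add: compatible_dist_def)
  have top: "mtopology = euclidean" using assms by (simp add: compatible_dist_def)
  show "0 \<le> d z x" "d x x = 0" by auto
  have op: "open (mball z r)" for z r using openin_mball[of z r] by (simp add: top)
  show "continuous_on UNIV (\<lambda>z. d z x)"
    unfolding continuous_on_def tendsto_iff
  proof (intro ballI allI impI)
    fix z and e :: real assume "e > 0"
    then have "\<forall>\<^sub>F w in nhds z. w \<in> mball z e" using op by (intro eventually_nhds_in_open) auto
    then have "\<forall>\<^sub>F w in nhds z. dist (d w x) (d z x) < e"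
    proof eventually_elim
      case (elim w)
      then show ?case
        using triangle[of w z x] triangle[of z w x] commute[of w z]
        by (auto simp: dist_real_def)
    qed
    then show "\<forall>\<^sub>F w in at z. dist (d w x) (d z x) < e"
      by (simp add: eventually_at_filter eventually_mono)
  qed
  show "\<exists>r>0. \<forall>z. d z x < r \<longrightarrow> z \<in> U" if U: "open U" "x \<in> U"
  proof -
    have "openin mtopology U" using U(1) by (simp add: top)
    then obtain r where "r > 0" "mball x r \<subseteq> U" using U(2) by (auto simp: openin_mtopology)
    then show ?thesis by (intro exI[of _ r]) (auto simp: subset_iff commute[of x])
  qed
qed

lemma continuous_sum_dist:
  assumes "compatible_dist dX" "compatible_dist dY"
  shows "continuous_on UNIV (\<lambda>z. dX (fst z) x + dY (snd z) y)"
  by (intro continuous_intros continuous_on_compose2[OF compatible_dist_continuous[OF assms(1)]]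
      continuous_on_compose2[OF compatible_dist_continuous[OF assms(2)]]) auto

lemma sum_dist_nhd:
  assumes d: "compatible_dist dX" "compatible_dist dY"
    and UV: "open U" "x \<in> U" "open V" "y \<in> V"
  obtains r where "r > 0" "\<forall>u v. dX u x + dY v y < r \<longrightarrow> u \<in> U \<and> v \<in> V"
proof -
  obtain r1 where r1: "r1 > 0" "\<And>u. dX u x < r1 \<Longrightarrow> u \<in> U"
    using compatible_dist_nhd[OF d(1)] UV by metis
  obtain r2 where r2: "r2 > 0" "\<And>v. dY v y < r2 \<Longrightarrow> v \<in> V"
    using compatible_dist_nhd[OF d(2)] UV by metis
  show thesis
  proof (rule that[of "min r1 r2"])
    show "\<forall>u v. dX u x + dY v y < min r1 r2 \<longrightarrow> u \<in> U \<and> v \<in> V"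
    proof (intro allI impI)
      fix u v assume "dX u x + dY v y < min r1 r2"
      then have "dX u x < r1" "dY v y < r2"
        using compatible_dist_nonneg[OF d(1), of u x] compatible_dist_nonneg[OF d(2), of v y]
        by linarith+
      then show "u \<in> U \<and> v \<in> V" using r1(2) r2(2) by blast
    qed
  qed (use r1 r2 in auto)
qed

text \<open>
  If \<open>S < \<delta>\<close> with \<open>\<delta>\<close> chosen by continuity of \<open>q\<close> at zero, then \<open>q S < r / 2\<close>. Hence \<open>S' < r\<close>, unless the
  superexponentially unlikely event with \<open>\<epsilon> = r / 2\<close> occurs, whose probability is \<open>b n\<close>. The
  roles of \<open>S\<close> and \<open>S'\<close> are played in turn by the distance of \<open>(\<xi>\<^sub>n, \<eta>\<^sub>n)\<close> to \<open>(x, y)\<close> and by that of the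
  decoupled pair.
\<close>

lemma exponential_equivalence_transfer:
  fixes q :: "real \<Rightarrow> real" and S S' :: "nat \<Rightarrow> 'a \<Rightarrow> real"
  assumes P: "\<And>n. prob_space (P n)"
    and meas: "\<And>n. S n \<in> borel_measurable (P n)" "\<And>n. S' n \<in> borel_measurable (P n)"
    and nonneg: "\<And>n \<omega>. 0 \<le> S n \<omega>"
    and q: "continuous_on {0..} q" "q 0 = 0"
    and small: "\<And>\<epsilon>. \<epsilon> > 0 \<Longrightarrow> limsup (\<lambda>n. log_rate (a n)
      (measure (P n) {\<omega> \<in> space (P n). S' n \<omega> \<ge> q (S n \<omega>) + \<epsilon>})) = -\<infinity>"
    and r: "r > 0"
  obtains \<delta> b where "\<delta> > 0"
    "\<forall>n. (0 :: real) \<le> b n" "limsup (\<lambda>n. log_rate (a n) (b n)) = -\<infinity>"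
    "\<forall>n. measure (P n) {\<omega> \<in> space (P n). S n \<omega> < \<delta>}
       \<le> measure (P n) {\<omega> \<in> space (P n). S' n \<omega> < r} + b n"
proof -
  have "\<exists>\<delta>>0. \<forall>s\<in>{0..}. dist s 0 < \<delta> \<longrightarrow> dist (q s) (q 0) < r / 2"
    using q(1) r unfolding continuous_on_iff by (meson atLeast_iff half_gt_zero order_refl)
  then obtain \<delta> where \<delta>: "\<delta> > 0" "\<And>s. 0 \<le> s \<Longrightarrow> s < \<delta> \<Longrightarrow> q s < r / 2"
    using q(2) by (force simp: dist_real_def)
  define E where "E n = {\<omega> \<in> space (P n). S' n \<omega> \<ge> q (S n \<omega>) + r / 2}" for n
  show thesis
  proof (rule that[of \<delta> "\<lambda>n. measure (P n) (E n)"])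
    show "limsup (\<lambda>n. log_rate (a n) (measure (P n) (E n))) = -\<infinity>"
      using small[of "r / 2"] r by (simp add: E_def)
    show "\<forall>n. measure (P n) {\<omega> \<in> space (P n). S n \<omega> < \<delta>}
      \<le> measure (P n) {\<omega> \<in> space (P n). S' n \<omega> < r} + measure (P n) (E n)"
    proof
      fix n
      interpret prob_space "P n" by (rule P)
      have [measurable]: "S n \<in> borel_measurable (P n)" "S' n \<in> borel_measurable (P n)"
        by (fact meas)+
      \<comment> \<open>\<open>q\<close> is continuous on the half-line only, so its measurability is obtained through \<open>max 0\<close>.\<close>
      have "continuous_on UNIV (\<lambda>s. q (max 0 s))"
        by (rule continuous_on_compose2[OF q(1)]) (auto intro!: continuous_intros)
      then have [measurable]: "(\<lambda>s. q (max 0 s)) \<in> borel_measurable borel"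
        by (rule borel_measurable_continuous_onI)
      have "(\<lambda>\<omega>. q (max 0 (S n \<omega>))) \<in> borel_measurable (P n)" by measurable
      then have [measurable]: "(\<lambda>\<omega>. q (S n \<omega>)) \<in> borel_measurable (P n)"
        using nonneg by (simp add: max_absorb2)
      have "prob {\<omega> \<in> space (P n). S n \<omega> < \<delta>} \<le> prob ({\<omega> \<in> space (P n). S' n \<omega> < r} \<union> E n)"
      proof (rule finite_measure_mono)
        show "{\<omega> \<in> space (P n). S n \<omega> < \<delta>} \<subseteq> {\<omega> \<in> space (P n). S' n \<omega> < r} \<union> E n"
          using \<delta>(2) nonneg by (force simp: E_def not_le)
        show "{\<omega> \<in> space (P n). S' n \<omega> < r} \<union> E n \<in> events" unfolding E_def by measurable
      qed
      also have "\<dots> \<le> prob {\<omega> \<in> space (P n). S' n \<omega> < r} + prob (E n)"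
        by (rule measure_Un_le) (unfold E_def, measurable)
      finally show "prob {\<omega> \<in> space (P n). S n \<omega> < \<delta>}
        \<le> prob {\<omega> \<in> space (P n). S' n \<omega> < r} + prob (E n)" .
    qed
  qed (use \<delta> in auto)
qed

section \<open>Independence and sums of rates\<close>

lemma measure_pair_rectangle:
  assumes A: "prob_space A" and B: "prob_space B"
    and u: "u \<in> A \<rightarrow>\<^sub>M borel" and v: "v \<in> B \<rightarrow>\<^sub>M borel"
    and U: "U \<in> sets borel" and V: "V \<in> sets borel"
  shows "measure (A \<Otimes>\<^sub>M B) {\<omega> \<in> space (A \<Otimes>\<^sub>M B). u (fst \<omega>) \<in> U \<and> v (snd \<omega>) \<in> V}
    = measure (distr A borel u) U * measure (distr B borel v) V"
proof -
  interpret A: prob_space A by (rule A)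
  interpret B: prob_space B by (rule B)
  have "{\<omega> \<in> space (A \<Otimes>\<^sub>M B). u (fst \<omega>) \<in> U \<and> v (snd \<omega>) \<in> V}
      = (u -` U \<inter> space A) \<times> (v -` V \<inter> space B)"
    by (auto simp: space_pair_measure)
  moreover have "emeasure (A \<Otimes>\<^sub>M B) ((u -` U \<inter> space A) \<times> (v -` V \<inter> space B))
      = emeasure A (u -` U \<inter> space A) * emeasure B (v -` V \<inter> space B)"
    using u v U V by (intro B.emeasure_pair_measure_Times) (auto intro: measurable_sets)
  ultimately show ?thesis
    using u v U V by (simp add: measure_def emeasure_distr enn2real_mult)
qed

lemma uminus_enn2ereal_add: "- enn2ereal (s + t) = - enn2ereal s + - enn2ereal t"
  by (cases s; cases t) (simp_all add: plus_ennreal.rep_eq enn2ereal_ennreal)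

text \<open>
  A level strictly below a sum is shared between the summands so that each share is strictly below its
  summand, up to shares that are zero. If \<open>t\<close> is at least as large as \<open>u\<close> and \<open>v\<close>, all three are finite
  and both summands give up half of the excess \<open>u + v - t\<close>.
\<close>

lemma ennreal_less_add_split:
  fixes t u v :: ennreal
  assumes "t < u + v"
  obtains t\<^sub>1 t\<^sub>2 where "t \<le> t\<^sub>1 + t\<^sub>2" "t\<^sub>1 < u \<or> t\<^sub>1 = 0" "t\<^sub>2 < v \<or> t\<^sub>2 = 0"
proof (cases "t < u \<or> t < v")
  case True
  with that[of t 0] that[of 0 t] show ?thesis by auto
next
  case False
  moreover have "t < top" using assms by (rule order_less_le_trans) simp
  ultimately obtain a b c where abc: "t = ennreal a" "u = ennreal b" "v = ennreal c"
    "0 \<le> a" "0 \<le> b" "0 \<le> c" "b \<le> a" "c \<le> a"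
    by (cases t; cases u; cases v) (auto simp: not_less)
  then have lt: "a < b + c" using assms by (simp add: ennreal_less_iff flip: ennreal_plus)
  show ?thesis
  proof (rule that[of "ennreal ((a + b - c) / 2)" "ennreal ((a + c - b) / 2)"])
    show "t \<le> ennreal ((a + b - c) / 2) + ennreal ((a + c - b) / 2)"
      using abc by (simp flip: ennreal_plus add: field_simps)
  qed (use abc lt in \<open>auto simp: ennreal_less_iff\<close>)
qed

section \<open>The coupled pair\<close>

theorem theorem4p6:
  fixes \<Omega>\<^sub>1 :: "'o1 set" and \<FF>\<^sub>1 :: "'o1 set set" and P\<^sub>1 :: "nat \<Rightarrow> 'o1 measure"
    and \<Omega>\<^sub>2 :: "'o2 set" and \<FF>\<^sub>2 :: "'o2 set set" and P\<^sub>2 :: "nat \<Rightarrow> 'o2 measure"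
    and P :: "nat \<Rightarrow> ('o1 \<times> 'o2) measure"
    and a :: "nat \<Rightarrow> real"
    and dX :: "'x::polish_space \<Rightarrow> 'x \<Rightarrow> real"
    and dY :: "'y::polish_space \<Rightarrow> 'y \<Rightarrow> real"
    and F :: "nat \<Rightarrow> 'y \<times> 'o1 \<Rightarrow> 'x"
    and G :: "nat \<Rightarrow> 'x \<times> 'o2 \<Rightarrow> 'y"
    and \<xi> :: "nat \<Rightarrow> 'o1 \<times> 'o2 \<Rightarrow> 'x"
    and \<eta> :: "nat \<Rightarrow> 'o1 \<times> 'o2 \<Rightarrow> 'y"
    and f :: "nat \<Rightarrow> 'y \<Rightarrow> 'o1 \<Rightarrow> 'x"
    and g :: "nat \<Rightarrow> 'x \<Rightarrow> 'o2 \<Rightarrow> 'y"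
    and \<mu> :: "nat \<Rightarrow> 'y \<Rightarrow> 'x measure"
    and \<nu> :: "nat \<Rightarrow> 'x \<Rightarrow> 'y measure"
    and K :: "'y \<Rightarrow> 'x \<Rightarrow> ennreal"
    and J :: "'x \<Rightarrow> 'y \<Rightarrow> ennreal"
    and I :: "'x \<times> 'y \<Rightarrow> ennreal"
    and \<gamma> :: "nat \<Rightarrow> ('x \<times> 'y) measure"
  assumes "\<And>n. standard_prob_space (P\<^sub>1 n) \<and> space (P\<^sub>1 n) = \<Omega>\<^sub>1 \<and> sets (P\<^sub>1 n) = \<FF>\<^sub>1"
    and "\<And>n. standard_prob_space (P\<^sub>2 n) \<and> space (P\<^sub>2 n) = \<Omega>\<^sub>2 \<and> sets (P\<^sub>2 n) = \<FF>\<^sub>2"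
    and "\<And>n. P n = P\<^sub>1 n \<Otimes>\<^sub>M P\<^sub>2 n"
    and "\<And>n. a n > 0" and "filterlim a at_top sequentially"
    and "compatible_dist dX" and "compatible_dist dY"
    and "\<And>n. F n \<in> borel \<Otimes>\<^sub>M P\<^sub>1 n \<rightarrow>\<^sub>M borel"
    and "\<And>n. G n \<in> borel \<Otimes>\<^sub>M P\<^sub>2 n \<rightarrow>\<^sub>M borel"
    and "\<And>n. \<xi> n \<in> P n \<rightarrow>\<^sub>M borel"
    and "\<And>n. \<eta> n \<in> P n \<rightarrow>\<^sub>M borel"
    and "\<And>n. AE (\<omega>\<^sub>1, \<omega>\<^sub>2) in P n.
           \<xi> n (\<omega>\<^sub>1, \<omega>\<^sub>2) = F n (\<eta> n (\<omega>\<^sub>1, \<omega>\<^sub>2), \<omega>\<^sub>1) \<and>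
           \<eta> n (\<omega>\<^sub>1, \<omega>\<^sub>2) = G n (\<xi> n (\<omega>\<^sub>1, \<omega>\<^sub>2), \<omega>\<^sub>2)"
    and "\<And>n y \<omega>\<^sub>1. f n y \<omega>\<^sub>1 = F n (y, \<omega>\<^sub>1)"
    and "\<And>n x \<omega>\<^sub>2. g n x \<omega>\<^sub>2 = G n (x, \<omega>\<^sub>2)"
    and "\<And>n y. \<mu> n y = distr (P\<^sub>1 n) borel (f n y)"
    and "\<And>n x. \<nu> n x = distr (P\<^sub>2 n) borel (g n x)"
    and "\<And>x y. \<exists>q :: real \<Rightarrow> real.
           continuous_on {0..} q \<and> bounded (q ` {0..}) \<and> (\<forall>s\<ge>0. q s \<ge> 0) \<and> q 0 = 0 \<and>
           weak_LDP (\<lambda>n. \<mu> n y) a (K y) \<and>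
           weak_LDP (\<lambda>n. \<nu> n x) a (J x) \<and>
           (\<forall>\<epsilon>>0. limsup (\<lambda>n. ereal (1 / a n) * elog (measure (P n)
              {(\<omega>\<^sub>1, \<omega>\<^sub>2) \<in> space (P n).
                 dX (\<xi> n (\<omega>\<^sub>1, \<omega>\<^sub>2)) x + dY (\<eta> n (\<omega>\<^sub>1, \<omega>\<^sub>2)) y
                   \<ge> q (dX (f n y \<omega>\<^sub>1) x + dY (g n x \<omega>\<^sub>2) y) + \<epsilon>})) = -\<infinity>) \<and>
           (\<forall>\<epsilon>>0. limsup (\<lambda>n. ereal (1 / a n) * elog (measure (P n)
              {(\<omega>\<^sub>1, \<omega>\<^sub>2) \<in> space (P n).
                 dX (f n y \<omega>\<^sub>1) x + dY (g n x \<omega>\<^sub>2) y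
                   \<ge> q (dX (\<xi> n (\<omega>\<^sub>1, \<omega>\<^sub>2)) x + dY (\<eta> n (\<omega>\<^sub>1, \<omega>\<^sub>2)) y) + \<epsilon>})) = -\<infinity>)"
    and "I = lsc_envelope (\<lambda>(x, y). K y x + J x y)"
    and "\<And>n. \<gamma> n = distr (P n) borel (\<lambda>\<omega>. (\<xi> n \<omega>, \<eta> n \<omega>))"
  shows "weak_LDP \<gamma> a I"
proof -
  note std = assms(1,2) and P_eq = assms(3) and a = assms(4,5) and d = assms(6,7)
    and F_meas = assms(8) and G_meas = assms(9) and \<xi>_meas = assms(10) and \<eta>_meas = assms(11)
    and f_eq = assms(13) and g_eq = assms(14) and \<mu>_eq = assms(15) and \<nu>_eq = assms(16)
    and hyp = assms(17) and I_eq = assms(18) and \<gamma>_eq = assms(19)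
  have prob1: "prob_space (P\<^sub>1 n)" and prob2: "prob_space (P\<^sub>2 n)" for n
    using std by (auto simp: standard_prob_space_def)
  have prob: "prob_space (P n)" for n
    unfolding P_eq by (intro prob_space_pair prob1 prob2)
  have f_meas: "f n y \<in> P\<^sub>1 n \<rightarrow>\<^sub>M borel" for n y
  proof -
    have "(\<lambda>\<omega>. F n (y, \<omega>)) \<in> P\<^sub>1 n \<rightarrow>\<^sub>M borel"
      by (rule measurable_compose[OF _ F_meas]) simp
    then show ?thesis by (simp flip: f_eq)
  qed
  have g_meas: "g n x \<in> P\<^sub>2 n \<rightarrow>\<^sub>M borel" for n x
  proof -
    have "(\<lambda>\<omega>. G n (x, \<omega>)) \<in> P\<^sub>2 n \<rightarrow>\<^sub>M borel"
      by (rule measurable_compose[OF _ G_meas]) simp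
    then show ?thesis by (simp flip: g_eq)
  qed
  have pair_meas: "(\<lambda>\<omega>. (\<xi> n \<omega>, \<eta> n \<omega>)) \<in> P n \<rightarrow>\<^sub>M borel" for n
    by (intro borel_measurable_Pair \<xi>_meas \<eta>_meas)
  have decoupled_meas: "(\<lambda>\<omega>. (f n y (fst \<omega>), g n x (snd \<omega>))) \<in> P n \<rightarrow>\<^sub>M borel" for n x y
    unfolding P_eq
    by (intro borel_measurable_Pair measurable_compose[OF measurable_fst f_meas]
        measurable_compose[OF measurable_snd g_meas])
  have pair_event: "{\<omega> \<in> space (P n). (\<xi> n \<omega>, \<eta> n \<omega>) \<in> W} \<in> sets (P n)" if "open W" for n W
    using measurable_sets[OF pair_meas borel_open[OF that], of n]
    by (simp add: vimage_def Int_def conj_commute)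
  have decoupled_event: "{\<omega> \<in> space (P n). f n y (fst \<omega>) \<in> U \<and> g n x (snd \<omega>) \<in> V} \<in> sets (P n)"
    if "open U" "open V" for n x y U V
    using measurable_sets[OF decoupled_meas borel_open[OF open_Times[OF that]], of n y x]
    by (simp add: vimage_def Int_def conj_commute)
  have \<gamma>_prob: "prob_space (\<gamma> n) \<and> sets (\<gamma> n) = sets borel" for n
    unfolding \<gamma>_eq using prob_space.prob_space_distr[OF prob pair_meas] by simp
  have \<gamma>_open: "measure (\<gamma> n) W = measure (P n) {\<omega> \<in> space (P n). (\<xi> n \<omega>, \<eta> n \<omega>) \<in> W}"
    if "open W" for n W
    unfolding \<gamma>_eq using that pair_meas
    by (subst measure_distr) (auto intro!: arg_cong[where f = "measure (P n)"])
  have decoupled: "measure (P n) {\<omega> \<in> space (P n). f n y (fst \<omega>) \<in> U \<and> g n x (snd \<omega>) \<in> V}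
      = measure (\<mu> n y) U * measure (\<nu> n x) V" if "open U" "open V" for n x y U V
    unfolding P_eq \<mu>_eq \<nu>_eq
    using that by (intro measure_pair_rectangle prob1 prob2 f_meas g_meas) auto
  define S where "S x y n \<omega> = dX (\<xi> n \<omega>) x + dY (\<eta> n \<omega>) y" for x y n \<omega>
  define S' where "S' x y n \<omega> = dX (f n y (fst \<omega>)) x + dY (g n x (snd \<omega>)) y" for x y n \<omega>
  have S_meas: "S x y n \<in> borel_measurable (P n)" for x y n
    using measurable_compose[OF pair_meas
        borel_measurable_continuous_onI[OF continuous_sum_dist[OF d, of x y]]]
    by (simp add: S_def[abs_def])
  have S'_meas: "S' x y n \<in> borel_measurable (P n)" for x y n
    using measurable_compose[OF decoupled_meas
        borel_measurable_continuous_onI[OF continuous_sum_dist[OF d, of x y]]]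
    by (simp add: S'_def[abs_def])
  have nonneg: "0 \<le> S x y n \<omega>" "0 \<le> S' x y n \<omega>" for x y n \<omega>
    using compatible_dist_nonneg[OF d(1)] compatible_dist_nonneg[OF d(2)]
    by (auto simp: S_def S'_def)
  have LDP: "weak_LDP (\<lambda>n. \<mu> n y) a (K y)" "weak_LDP (\<lambda>n. \<nu> n x) a (J x)" for x y
    using hyp[where x = x and y = y] by blast+
  have equivalence: "\<exists>q. continuous_on {0..} q \<and> q 0 = (0 :: real) \<and>
      (\<forall>\<epsilon>>0. limsup (\<lambda>n. log_rate (a n)
        (measure (P n) {\<omega> \<in> space (P n). S x y n \<omega> \<ge> q (S' x y n \<omega>) + \<epsilon>})) = -\<infinity>) \<and>
      (\<forall>\<epsilon>>0. limsup (\<lambda>n. log_rate (a n)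
        (measure (P n) {\<omega> \<in> space (P n). S' x y n \<omega> \<ge> q (S x y n \<omega>) + \<epsilon>})) = -\<infinity>)" for x y
    using hyp[where x = x and y = y] unfolding S_def S'_def case_prod_beta prod.collapse by blast
  \<comment> \<open>At a point \<open>(x, y)\<close> the pair is compared with the decoupled one built from the same \<open>(x, y)\<close>.\<close>
  show ?thesis
    unfolding I_eq
  proof (rule weak_LDP_of_local_bounds[OF a \<gamma>_prob])
    fix z :: "'x \<times> 'y" and W assume W: "open W" "z \<in> W"
    obtain x y where z: "z = (x, y)" by (cases z)
    obtain U V where UV: "open U" "open V" "x \<in> U" "y \<in> V" "U \<times> V \<subseteq> W"
      using open_prod_elim[OF W] z by (metis mem_Sigma_iff)
    obtain r where r: "r > 0" "\<forall>u v. dX u x + dY v y < r \<longrightarrow> u \<in> U \<and> v \<in> V"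
      by (rule sum_dist_nhd[OF d UV(1,3,2,4)])
    obtain q where q: "continuous_on {0..} q" "q 0 = (0 :: real)"
      "\<And>\<epsilon>. \<epsilon> > 0 \<Longrightarrow> limsup (\<lambda>n. log_rate (a n)
        (measure (P n) {\<omega> \<in> space (P n). S x y n \<omega> \<ge> q (S' x y n \<omega>) + \<epsilon>})) = -\<infinity>"
      using equivalence[of x y] by blast
    obtain \<delta> b where \<delta>: "\<delta> > 0" and b: "\<forall>n. (0 :: real) \<le> b n"
      "limsup (\<lambda>n. log_rate (a n) (b n)) = -\<infinity>"
      "\<forall>n. measure (P n) {\<omega> \<in> space (P n). S' x y n \<omega> < \<delta>}
         \<le> measure (P n) {\<omega> \<in> space (P n). S x y n \<omega> < r} + b n"
      by (rule exponential_equivalence_transfer[where S = "S' x y" and S' = "S x y",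
            OF prob S'_meas S_meas nonneg(2) q r(1)])
    define A where "A = {u. dX u x < \<delta> / 2}"
    define B where "B = {v. dY v y < \<delta> / 2}"
    have AB: "open A" "x \<in> A" "open B" "y \<in> B"
    proof -
      show "open A" "open B"
        unfolding A_def B_def
        by (rule open_Collect_less[OF compatible_dist_continuous[OF d(1)] continuous_on_const]
            open_Collect_less[OF compatible_dist_continuous[OF d(2)] continuous_on_const])+
      show "x \<in> A" "y \<in> B"
        using \<delta> by (simp_all add: A_def B_def compatible_dist_self[OF d(1)] compatible_dist_self[OF d(2)])
    qed
    have decomposition: "measure (\<mu> n y) A * measure (\<nu> n x) B \<le> measure (\<gamma> n) W + b n" for n
    proof -
      interpret prob_space "P n" by (rule prob)
      have "measure (\<mu> n y) A * measure (\<nu> n x) B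
          = prob {\<omega> \<in> space (P n). f n y (fst \<omega>) \<in> A \<and> g n x (snd \<omega>) \<in> B}"
        by (rule decoupled[symmetric]) (fact AB)+
      also have "\<dots> \<le> prob {\<omega> \<in> space (P n). S' x y n \<omega> < \<delta>}"
      proof (rule finite_measure_mono)
        show "{\<omega> \<in> space (P n). S' x y n \<omega> < \<delta>} \<in> events"
          using S'_meas[of x y n] by measurable
      qed (auto simp: A_def B_def S'_def)
      also note b(3)[rule_format, of n]
      also have "prob {\<omega> \<in> space (P n). S x y n \<omega> < r} \<le> measure (\<gamma> n) W"
        unfolding \<gamma>_open[OF W(1)]
        using r(2) UV(5) pair_event[OF W(1)]
        by (intro finite_measure_mono) (auto simp: S_def)
      finally show ?thesis by simp
    qed
    let ?lA = "liminf (\<lambda>n. log_rate (a n) (measure (\<mu> n y) A))"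
    let ?lB = "liminf (\<lambda>n. log_rate (a n) (measure (\<nu> n x) B))"
    \<comment> \<open>The logarithmic rates of probabilities are nonpositive, so the sum of the two lower limits
      is never \<open>\<infinity> - \<infinity>\<close>.\<close>
    have nonpos: "?lA \<le> 0" "?lB \<le> 0"
      by (rule order_trans[OF Liminf_le_Limsup limsup_log_rate_nonpos];
          use a(1) LDP in \<open>simp add: weak_LDP_def\<close>)+
    have "- enn2ereal (case z of (x, y) \<Rightarrow> K y x + J x y) = - enn2ereal (K y x) + - enn2ereal (J x y)"
      by (simp add: z uminus_enn2ereal_add)
    also have "\<dots> \<le> ?lA + ?lB"
      by (intro add_mono weak_LDP_local_lower_bound LDP AB)
    also have "\<dots> \<le> liminf (\<lambda>n. log_rate (a n) (measure (\<mu> n y) A)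
        + log_rate (a n) (measure (\<nu> n x) B))"
      using nonpos by (intro ereal_liminf_add_mono) auto
    also have "\<dots> = liminf (\<lambda>n. log_rate (a n) (measure (\<mu> n y) A * measure (\<nu> n x) B))"
      using a(1) by (simp only: log_rate_mult measure_nonneg)
    finally have product: "- enn2ereal (case z of (x, y) \<Rightarrow> K y x + J x y)
        \<le> liminf (\<lambda>n. log_rate (a n) (measure (\<mu> n y) A * measure (\<nu> n x) B))" .
    show "- enn2ereal (case z of (x, y) \<Rightarrow> K y x + J x y)
        \<le> liminf (\<lambda>n. log_rate (a n) (measure (\<gamma> n) W))"
      by (rule le_liminf_log_rate_of_negligible[OF a _ measure_nonneg b(1)[rule_format]
            decomposition product b(2)])
        (simp add: measure_nonneg)
  next
    fix z :: "'x \<times> 'y" and t assume t: "t < (case z of (x, y) \<Rightarrow> K y x + J x y)"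
    obtain x y where z: "z = (x, y)" by (cases z)
    obtain t\<^sub>1 t\<^sub>2 where t12: "t \<le> t\<^sub>1 + t\<^sub>2" "t\<^sub>1 < K y x \<or> t\<^sub>1 = 0" "t\<^sub>2 < J x y \<or> t\<^sub>2 = 0"
      by (rule ennreal_less_add_split[of t "K y x" "J x y"]) (use t z in auto)
    obtain U where U: "open U" "x \<in> U"
      "limsup (\<lambda>n. log_rate (a n) (measure (\<mu> n y) U)) \<le> - enn2ereal t\<^sub>1"
      by (rule weak_LDP_local_upper_bound_or_zero[OF a(1) LDP(1) t12(2)])
    obtain V where V: "open V" "y \<in> V"
      "limsup (\<lambda>n. log_rate (a n) (measure (\<nu> n x) V)) \<le> - enn2ereal t\<^sub>2"
      by (rule weak_LDP_local_upper_bound_or_zero[OF a(1) LDP(2) t12(3)])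
    obtain r where r: "r > 0" "\<forall>u v. dX u x + dY v y < r \<longrightarrow> u \<in> U \<and> v \<in> V"
      by (rule sum_dist_nhd[OF d U(1,2) V(1,2)])
    obtain q where q: "continuous_on {0..} q" "q 0 = (0 :: real)"
      "\<And>\<epsilon>. \<epsilon> > 0 \<Longrightarrow> limsup (\<lambda>n. log_rate (a n)
        (measure (P n) {\<omega> \<in> space (P n). S' x y n \<omega> \<ge> q (S x y n \<omega>) + \<epsilon>})) = -\<infinity>"
      using equivalence[of x y] by blast
    obtain \<delta> b where \<delta>: "\<delta> > 0" and b: "\<forall>n. (0 :: real) \<le> b n"
      "limsup (\<lambda>n. log_rate (a n) (b n)) = -\<infinity>"
      "\<forall>n. measure (P n) {\<omega> \<in> space (P n). S x y n \<omega> < \<delta>}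
         \<le> measure (P n) {\<omega> \<in> space (P n). S' x y n \<omega> < r} + b n"
      by (rule exponential_equivalence_transfer[where S = "S x y" and S' = "S' x y",
            OF prob S_meas S'_meas nonneg(1) q r(1)])
    define W where "W = {w. dX (fst w) x + dY (snd w) y < \<delta>}"
    have W: "open W" "z \<in> W"
    proof -
      show "open W"
        unfolding W_def by (rule open_Collect_less[OF continuous_sum_dist[OF d] continuous_on_const])
      show "z \<in> W"
        using \<delta> by (simp add: W_def z compatible_dist_self[OF d(1)] compatible_dist_self[OF d(2)])
    qed
    have decomposition: "measure (\<gamma> n) W \<le> measure (\<mu> n y) U * measure (\<nu> n x) V + b n" for n
    proof -
      interpret prob_space "P n" by (rule prob)
      have "measure (\<gamma> n) W = prob {\<omega> \<in> space (P n). S x y n \<omega> < \<delta>}"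
        unfolding \<gamma>_open[OF W(1)] by (simp add: W_def S_def)
      also note b(3)[rule_format, of n]
      also have "prob {\<omega> \<in> space (P n). S' x y n \<omega> < r}
          \<le> prob {\<omega> \<in> space (P n). f n y (fst \<omega>) \<in> U \<and> g n x (snd \<omega>) \<in> V}"
        using r(2) decoupled_event[OF U(1) V(1)]
        by (intro finite_measure_mono) (auto simp: S'_def)
      also note decoupled[OF U(1) V(1)]
      finally show ?thesis by simp
    qed
    have "limsup (\<lambda>n. log_rate (a n) (measure (\<mu> n y) U * measure (\<nu> n x) V))
        = limsup (\<lambda>n. log_rate (a n) (measure (\<mu> n y) U) + log_rate (a n) (measure (\<nu> n x) V))"
      using a(1) by (simp only: log_rate_mult measure_nonneg)
    also have "\<dots> \<le> limsup (\<lambda>n. log_rate (a n) (measure (\<mu> n y) U))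
        + limsup (\<lambda>n. log_rate (a n) (measure (\<nu> n x) V))"
      by (rule ereal_limsup_add_mono)
    also have "\<dots> \<le> - enn2ereal t\<^sub>1 + - enn2ereal t\<^sub>2" by (intro add_mono U(3) V(3))
    also have "\<dots> = - enn2ereal (t\<^sub>1 + t\<^sub>2)"
      by (simp add: uminus_enn2ereal_add)
    also have "\<dots> \<le> - enn2ereal t" using t12(1) by (simp add: less_eq_ennreal.rep_eq)
    finally have product: "limsup (\<lambda>n. log_rate (a n) (measure (\<mu> n y) U * measure (\<nu> n x) V))
        \<le> - enn2ereal t" .
    have "limsup (\<lambda>n. log_rate (a n) (b n)) \<le> - enn2ereal t" unfolding b(2) by simp
    then have "limsup (\<lambda>n. log_rate (a n) (measure (\<gamma> n) W)) \<le> - enn2ereal t"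
      by (intro limsup_log_rate_add_le[OF a measure_nonneg _ b(1)[rule_format] decomposition product])
        (simp add: measure_nonneg)
    with W show "\<exists>W. open W \<and> z \<in> W \<and>
        limsup (\<lambda>n. log_rate (a n) (measure (\<gamma> n) W)) \<le> - enn2ereal t"
      by blast
  qed
qed

end
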